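(* Let $d=2$ and let $\{P_n\}$ be a monic $2$-OPS. For any integers $k>m>n\ge0$ and $r\ge0$, $$\begin{vmatrix}P_n^{(r)}&P_{n-1}^{(r+1)}&P_{n-2}^{(r+2)}\\P_m^{(r)}&P_{m-1}^{(r+1)}&P_{m-2}^{(r+2)}\\P_k^{(r)}&P_{k-1}^{(r+1)}&P_{k-2}^{(r+2)}\end{vmatrix} =\Delta_n^{(r)}\left[P_{k-m-1}^{(m+r+1)}\begin{vmatrix}P_{m-n-1}^{(r+n+1)}&P_{m-n-2}^{(r+n+2)}\\P_{m-n}^{(r+n+1)}&P_{m-n-1}^{(r+n+2)}\end{vmatrix} +\gamma_{m+r}^0P_{k-m-2}^{(m+r+2)}\begin{vmatrix}P_{m-n-2}^{(r+n+1)}&P_{m-n-3}^{(r+n+2)}\\P_{m-n-1}^{(r+n+1)}&P_{m-n-2}^{(r+n+2)}\end{vmatrix}\right].$$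
   Context: A monic $2$-OPS is given by complex numbers $\beta_n$ ($n\ge0$), $\gamma_n^0,\gamma_n^1$ ($n\ge1$) with $\gamma_n^0\ne0$ for all $n\ge1$. For $r\ge0$ the associated sequence of order $r$ is defined by $P_n^{(r)}=0$ for $n<0$, $P_0^{(r)}=1$ and $$P_{n+1}^{(r)}(x)=(x-\beta_{n+r})P_n^{(r)}(x)-\gamma_{n+r}^1P_{n-1}^{(r)}(x)-\gamma_{n+r-1}^0P_{n-2}^{(r)}(x),\quad n\ge0,$$ where terms with a polynomial of negative index are zero; $P_n=P_n^{(0)}$. $\Delta_n^{(r)}$ denotes the $3\times3$ determinant $\det\big(P_{n+j-i}^{(r+i)}\big)_{0\le j,i\le2}$ ($j$ row, $i$ column index). *)

theory Defs
  imports "HOL-Analysis.Determinants" "HOL-Computational_Algebra.Polynomial"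
begin

text \<open>
  \<open>assoc_poly \<beta> \<gamma>0 \<gamma>1 r k\<close> is $P_k^{(r)}$, with an integer degree index \<open>k\<close>
  because negative indices occur (and give the zero polynomial).
  The recurrence reaches the values \<open>\<gamma>0 0\<close> and \<open>\<gamma>1 0\<close>, which are not part of the data
  of a 2-OPS (nor is the $\gamma^0_{-1}$ that truncated subtraction turns into \<open>\<gamma>0 0\<close>),
  only as factors of a polynomial of negative index.
\<close>

function assoc_poly ::
  "(nat \<Rightarrow> complex) \<Rightarrow> (nat \<Rightarrow> complex) \<Rightarrow> (nat \<Rightarrow> complex) \<Rightarrow> nat \<Rightarrow> int \<Rightarrow> complex poly"
where
  "assoc_poly \<beta> \<gamma>0 \<gamma>1 r k =
     (if k < 0 then 0
      else if k = 0 then 1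
      else (let n = nat (k - 1) in
          [:- \<beta> (n + r), 1:] * assoc_poly \<beta> \<gamma>0 \<gamma>1 r (k - 1)
        - smult (\<gamma>1 (n + r)) (assoc_poly \<beta> \<gamma>0 \<gamma>1 r (k - 2))
        - smult (\<gamma>0 (n + r - 1)) (assoc_poly \<beta> \<gamma>0 \<gamma>1 r (k - 3))))"
  by pat_completeness auto
termination
  by (relation "measure (\<lambda>(\<beta>, \<gamma>0, \<gamma>1, r, k). nat (k + 3))") auto

declare assoc_poly.simps [simp del]

lemma assoc_poly_neg: "k < 0 \<Longrightarrow> assoc_poly \<beta> \<gamma>0 \<gamma>1 r k = 0"
  by (simp add: assoc_poly.simps)

lemma assoc_poly_0: "assoc_poly \<beta> \<gamma>0 \<gamma>1 r 0 = 1"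
  by (simp add: assoc_poly.simps)

lemma assoc_poly_rec:
  "assoc_poly \<beta> \<gamma>0 \<gamma>1 r (int n + 1) =
     [:- \<beta> (n + r), 1:] * assoc_poly \<beta> \<gamma>0 \<gamma>1 r (int n)
     - smult (\<gamma>1 (n + r)) (assoc_poly \<beta> \<gamma>0 \<gamma>1 r (int n - 1))
     - smult (\<gamma>0 (n + r - 1)) (assoc_poly \<beta> \<gamma>0 \<gamma>1 r (int n - 2))"
  by (subst assoc_poly.simps) (simp add: Let_def)

definition Delta ::
  "(nat \<Rightarrow> complex) \<Rightarrow> (nat \<Rightarrow> complex) \<Rightarrow> (nat \<Rightarrow> complex) \<Rightarrow> nat \<Rightarrow> int \<Rightarrow> complex poly"
where
  "Delta \<beta> \<gamma>0 \<gamma>1 r n =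
     (let P = assoc_poly \<beta> \<gamma>0 \<gamma>1 in
      det (vector
       [vector [P r n,       P (r + 1) (n - 1), P (r + 2) (n - 2)],
        vector [P r (n + 1), P (r + 1) n,       P (r + 2) (n - 1)],
        vector [P r (n + 2), P (r + 1) (n + 1), P (r + 2) n]] :: complex poly ^ 3 ^ 3))"

end

theory Submission imports Defs begin

text \<open>
  As functions of the row index, all three columns of the determinant solve the same
  four-term recurrence, whose solutions are determined by three consecutive values; the
  coordinates of a solution with respect to the values around an index are themselves
  associated polynomials. Expanding rows $m$ and $k$ around $n$ splits off $\Delta_n^{(r)}$ and
  leaves a $2\times2$ minor of two such solutions; expanding row $k$ of that minor around
  $m$ gives the bracket.
\<close>

text \<open>The lower bound \<open>a\<close> is needed because a column extended by zero below its
  starting index \<open>i\<close> > 0 violates the recurrence at \<open>j = i - 1\<close>, where it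
  would give 0 instead of the initial value 1.\<close>

definition solves_from ::
  "(nat \<Rightarrow> complex) \<Rightarrow> (nat \<Rightarrow> complex) \<Rightarrow> (nat \<Rightarrow> complex) \<Rightarrow> nat \<Rightarrow> nat \<Rightarrow>
    (int \<Rightarrow> complex poly) \<Rightarrow> bool"
where
  "solves_from \<beta> \<gamma>0 \<gamma>1 r a y \<longleftrightarrow>
     (\<forall>j\<ge>a. y (int j + 1) = [:- \<beta> (j + r), 1:] * y (int j)
        - smult (\<gamma>1 (j + r)) (y (int j - 1)) - smult (\<gamma>0 (j + r - 1)) (y (int j - 2)))"

lemma solves_fromD:
  assumes "solves_from \<beta> \<gamma>0 \<gamma>1 r a y" "a \<le> j"
  shows "y (int j + 1) = [:- \<beta> (j + r), 1:] * y (int j)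
    - smult (\<gamma>1 (j + r)) (y (int j - 1)) - smult (\<gamma>0 (j + r - 1)) (y (int j - 2))"
  using assms by (simp add: solves_from_def)

lemma solves_from_mono:
  "solves_from \<beta> \<gamma>0 \<gamma>1 r a y \<Longrightarrow> a \<le> b \<Longrightarrow> solves_from \<beta> \<gamma>0 \<gamma>1 r b y"
  by (simp add: solves_from_def)

text \<open>Raising the order by \<open>i\<close> while lowering the degree by \<open>i\<close>
  leaves degree plus order unchanged, and the recurrence coefficients depend only on that
  sum.\<close>

lemma assoc_poly_solves:
  "solves_from \<beta> \<gamma>0 \<gamma>1 r i (\<lambda>k. assoc_poly \<beta> \<gamma>0 \<gamma>1 (i + r) (k - int i))"
  unfolding solves_from_def
proof (intro allI impI)
  fix j assume "i \<le> j"
  then obtain l where j: "j = l + i" by (metis le_Suc_ex add.commute)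
  show "assoc_poly \<beta> \<gamma>0 \<gamma>1 (i + r) (int j + 1 - int i) =
      [:- \<beta> (j + r), 1:] * assoc_poly \<beta> \<gamma>0 \<gamma>1 (i + r) (int j - int i)
      - smult (\<gamma>1 (j + r)) (assoc_poly \<beta> \<gamma>0 \<gamma>1 (i + r) (int j - 1 - int i))
      - smult (\<gamma>0 (j + r - 1)) (assoc_poly \<beta> \<gamma>0 \<gamma>1 (i + r) (int j - 2 - int i))"
    using assoc_poly_rec[of \<beta> \<gamma>0 \<gamma>1 "i + r" l] by (simp add: j add.assoc)
qed

lemma assoc_poly_1: "assoc_poly \<beta> \<gamma>0 \<gamma>1 r 1 = [:- \<beta> r, 1:]"
  using assoc_poly_rec[of \<beta> \<gamma>0 \<gamma>1 r 0] by (simp add: assoc_poly_0 assoc_poly_neg)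

lemma assoc_poly_2:
  "assoc_poly \<beta> \<gamma>0 \<gamma>1 r 2 = [:- \<beta> (Suc r), 1:] * [:- \<beta> r, 1:] - [:\<gamma>1 (Suc r):]"
  using assoc_poly_rec[of \<beta> \<gamma>0 \<gamma>1 r 1]
  by (simp add: assoc_poly_0 assoc_poly_1 assoc_poly_neg one_pCons)

text \<open>Cut y to zero below \<open>a\<close>. The three coefficients are the defects of the
  recurrence for the cut sequence at \<open>a\<close>, \<open>a + 1\<close>, \<open>a + 2\<close>;
  each defect launches an associated sequence starting at that index, and from \<open>a + 3\<close>
  on there is no further defect. No \<open>\<gamma>0\<close> occurs, since it would multiply a value
  below \<open>a\<close>.\<close>

lemma solution_expansion:
  fixes \<beta> \<gamma>0 \<gamma>1
  defines "P \<equiv> assoc_poly \<beta> \<gamma>0 \<gamma>1"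
  assumes y: "solves_from \<beta> \<gamma>0 \<gamma>1 r (a + 2) y" and "a \<le> k"
  shows "y (int k) = y (int a) * P (a + r) (int k - int a)
    + (y (int a + 1) - [:- \<beta> (a + r), 1:] * y (int a)) * P (a + r + 1) (int k - int a - 1)
    + (y (int a + 2) - [:- \<beta> (a + r + 1), 1:] * y (int a + 1) + smult (\<gamma>1 (a + r + 1)) (y (int a)))
      * P (a + r + 2) (int k - int a - 2)"
  using \<open>a \<le> k\<close>
proof (induction k rule: less_induct)
  case (less k)
  consider "k = a" | "k = a + 1" | "k = a + 2" | "k \<ge> a + 3"
    using less.prems by linarith
  then show ?case
  proof cases
    case 1
    then show ?thesis by (simp add: P_def assoc_poly_0 assoc_poly_neg)
  next
    case 2
    then show ?thesis
      by (simp add: P_def assoc_poly_0 assoc_poly_1 assoc_poly_neg add.commute)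
  next
    case 3
    have "y (int k) = y (int a + 2)" using 3 by (simp add: add.commute)
    moreover have "smult (\<gamma>1 (a + r + 1)) (y (int a)) = [:\<gamma>1 (a + r + 1):] * y (int a)" by simp
    ultimately show ?thesis
      using 3 by (simp only: P_def)
        (simp add: assoc_poly_0 assoc_poly_1 assoc_poly_2 algebra_simps del: mult_pCons_left mult_pCons_right)
  next
    case 4
    define A where "A = (\<lambda>i k. P (a + i + r) (k - int (a + i)))"
    define c0 c1 c2 where "c0 = y (int a)"
      and "c1 = y (int a + 1) - [:- \<beta> (a + r), 1:] * y (int a)"
      and "c2 = y (int a + 2) - [:- \<beta> (a + r + 1), 1:] * y (int a + 1)
        + smult (\<gamma>1 (a + r + 1)) (y (int a))"
    \<comment> \<open>With j at least \<open>a + 2\<close>, the indices j, j - 1, j - 2 all lie in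
      the range of the induction hypothesis, and y and the three columns \<open>A i\<close> obey the
      recurrence at j. Linearity does the rest.\<close>
    obtain j where j: "a + 2 \<le> j" and k: "k = j + 1"
      using 4 by (intro that[of "k - 1"]) auto
    have cols: "solves_from \<beta> \<gamma>0 \<gamma>1 r (a + 2) (A i)" if "i \<le> 2" for i
      unfolding P_def A_def by (rule solves_from_mono[OF assoc_poly_solves]) (use that in simp)
    have ih: "y (int l) = c0 * A 0 (int l) + c1 * A 1 (int l) + c2 * A 2 (int l)"
      if "a \<le> l" "l < k" for l
      using less.IH[OF that(2,1)] by (simp add: A_def c0_def c1_def c2_def algebra_simps)
    have ihs: "y (int j) = c0 * A 0 (int j) + c1 * A 1 (int j) + c2 * A 2 (int j)"
      "y (int j - 1) = c0 * A 0 (int j - 1) + c1 * A 1 (int j - 1) + c2 * A 2 (int j - 1)"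
      "y (int j - 2) = c0 * A 0 (int j - 2) + c1 * A 1 (int j - 2) + c2 * A 2 (int j - 2)"
      using ih[of j] ih[of "j - 1"] ih[of "j - 2"] j k by auto
    note recs = solves_fromD[OF y j] solves_fromD[OF cols[of 0] j]
      solves_fromD[OF cols[of 1] j] solves_fromD[OF cols[of 2] j]
    have "y (int j + 1) = c0 * A 0 (int j + 1) + c1 * A 1 (int j + 1) + c2 * A 2 (int j + 1)"
      by (simp only: recs ihs) (simp add: algebra_simps smult_add_right smult_diff_right
          del: mult_pCons_left mult_pCons_right)
    then show ?thesis
      by (simp add: k A_def c0_def c1_def c2_def algebra_simps)
  qed
qed

text \<open>The dual recurrence, running in the order instead of the degree. It is the expansion of
  \<open>P r\<close> around index 1: the cut removes only the value 1 at index 0, so the second and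
  third defects are just the \<open>\<gamma>1\<close> and \<open>\<gamma>0\<close> terms of that
  value.\<close>

lemma assoc_poly_order_rec:
  fixes \<beta> \<gamma>0 \<gamma>1
  defines "P \<equiv> assoc_poly \<beta> \<gamma>0 \<gamma>1"
  assumes "1 \<le> k"
  shows "P r (int k) = [:- \<beta> r, 1:] * P (r + 1) (int k - 1)
    - smult (\<gamma>1 (r + 1)) (P (r + 2) (int k - 2)) - smult (\<gamma>0 (r + 1)) (P (r + 3) (int k - 3))"
proof -
  have y: "solves_from \<beta> \<gamma>0 \<gamma>1 r 0 (P r)"
    using assoc_poly_solves[of \<beta> \<gamma>0 \<gamma>1 r 0] by (simp add: P_def)
  have "P r 3 = [:- \<beta> (r + 2), 1:] * P r 2 - smult (\<gamma>1 (r + 2)) (P r 1) - [:\<gamma>0 (r + 1):]"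
    using solves_fromD[OF y, of 2] by (simp add: P_def assoc_poly_0 add.commute one_pCons)
  then show ?thesis
    using solution_expansion[OF solves_from_mono[OF y], of 1 k] assms(2)
    by (simp add: P_def assoc_poly_1 assoc_poly_2 add.commute numeral_eq_Suc)
qed

theorem theorem5p1:
  fixes \<beta> \<gamma>0 \<gamma>1 :: "nat \<Rightarrow> complex"
    and P :: "nat \<Rightarrow> int \<Rightarrow> complex poly"
    and r n m k :: nat
  assumes "\<And>i. i \<ge> 1 \<Longrightarrow> \<gamma>0 i \<noteq> 0"
    and "P = assoc_poly \<beta> \<gamma>0 \<gamma>1"
    and "n < m" and "m < k"
  shows
    "det (vector
       [vector [P r (int n), P (r + 1) (int n - 1), P (r + 2) (int n - 2)],
        vector [P r (int m), P (r + 1) (int m - 1), P (r + 2) (int m - 2)],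
        vector [P r (int k), P (r + 1) (int k - 1), P (r + 2) (int k - 2)]] :: complex poly ^ 3 ^ 3)
     = Delta \<beta> \<gamma>0 \<gamma>1 r (int n) *
       (P (m + r + 1) (int k - int m - 1) *
          det (vector
            [vector [P (r + n + 1) (int m - int n - 1), P (r + n + 2) (int m - int n - 2)],
             vector [P (r + n + 1) (int m - int n),     P (r + n + 2) (int m - int n - 1)]]
            :: complex poly ^ 2 ^ 2)
        + smult (\<gamma>0 (m + r)) (P (m + r + 2) (int k - int m - 2)) *
          det (vector
            [vector [P (r + n + 1) (int m - int n - 2), P (r + n + 2) (int m - int n - 3)],
             vector [P (r + n + 1) (int m - int n - 1), P (r + n + 2) (int m - int n - 2)]]
            :: complex poly ^ 2 ^ 2))"
proof -
  \<comment> \<open>These are the columns starting at n + 1 and n + 2, indexed by the row so that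
    they solve the common recurrence.\<close>
  define u v where "u = (\<lambda>j. P (r + n + 1) (j - int n - 1))"
    and "v = (\<lambda>j. P (r + n + 2) (j - int n - 2))"
  define X Y Z where "X = P r" and "Y = (\<lambda>j. P (r + 1) (j - 1))" and "Z = (\<lambda>j. P (r + 2) (j - 2))"
  have P: "P = assoc_poly \<beta> \<gamma>0 \<gamma>1" by fact
  have col: "solves_from \<beta> \<gamma>0 \<gamma>1 r b (\<lambda>k. P (i + r) (k - int i))" if "i \<le> b" for i b
    unfolding P by (rule solves_from_mono[OF assoc_poly_solves that])
  have XYZ: "solves_from \<beta> \<gamma>0 \<gamma>1 r (n + 2) X" "solves_from \<beta> \<gamma>0 \<gamma>1 r (n + 2) Y"
    "solves_from \<beta> \<gamma>0 \<gamma>1 r (n + 2) Z"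
    using col[of 0 "n + 2"] col[of 1 "n + 2"] col[of 2 "n + 2"]
    by (simp_all add: X_def Y_def Z_def add.commute)
  have row: "y (int l) = y (int n) * P (n + r) (int l - int n)
      + (y (int n + 1) - [:- \<beta> (n + r), 1:] * y (int n)) * u (int l)
      + (y (int n + 2) - [:- \<beta> (n + r + 1), 1:] * y (int n + 1)
          + smult (\<gamma>1 (n + r + 1)) (y (int n))) * v (int l)"
    if "solves_from \<beta> \<gamma>0 \<gamma>1 r (n + 2) y" "n \<le> l" for y l
    using solution_expansion[OF that] by (simp only: P u_def v_def add.commute[of r n])
  \<comment> \<open>Modulo row n, rows m and k are combinations of the same two rows, with
    coefficients u and v. Those two rows come from rows n + 1 and n + 2 by unitriangular row
    operations, so the determinant factors.\<close>
  have split: "det (vector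
       [vector [X (int n), Y (int n), Z (int n)],
        vector [X (int m), Y (int m), Z (int m)],
        vector [X (int k), Y (int k), Z (int k)]] :: complex poly ^ 3 ^ 3)
     = det (vector
       [vector [X (int n), Y (int n), Z (int n)],
        vector [X (int n + 1), Y (int n + 1), Z (int n + 1)],
        vector [X (int n + 2), Y (int n + 2), Z (int n + 2)]] :: complex poly ^ 3 ^ 3)
       * (u (int m) * v (int k) - u (int k) * v (int m))"
  proof -
    have "n \<le> m" "n \<le> k" using assms by auto
    note rows = XYZ[THEN row, OF this(1)] XYZ[THEN row, OF this(2)]
    have g: "smult c p = [:c:] * p" for c :: complex and p by simp
    show ?thesis
      unfolding det_3 vector_3 rows unfolding g by algebra
  qed
  have minor: "u (int m) * v (int k) - u (int k) * v (int m)
    = P (m + r + 1) (int k - int m - 1) * (u (int m) * v (int m + 1) - u (int m + 1) * v (int m))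
    + smult (\<gamma>0 (m + r)) (P (m + r + 2) (int k - int m - 2))
      * (u (int m - 1) * v (int m) - u (int m) * v (int m - 1))"
  proof -
    \<comment> \<open>Centring the expansion at m - 1 makes rows m - 1, m and m + 1 appear, as in
      the bracket. Since n < m, both u and v already solve the recurrence from
      \<open>a + 2\<close>.\<close>
    obtain a where m: "m = a + 1" and "n \<le> a"
      using \<open>n < m\<close> by (metis Suc_eq_plus1 less_imp_Suc_add le_add1)
    have uv: "solves_from \<beta> \<gamma>0 \<gamma>1 r (a + 2) u" "solves_from \<beta> \<gamma>0 \<gamma>1 r (a + 2) v"
      using col[of "n + 1" "a + 2"] col[of "n + 2" "a + 2"] \<open>n \<le> a\<close>
      by (simp_all add: u_def v_def algebra_simps)
    have "a \<le> k" "1 \<le> k - a" "int (k - a) = int k - int a" using m \<open>m < k\<close> by auto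
    note first = assoc_poly_order_rec[OF this(2), where r = "a + r", unfolded this(3)]
    \<comment> \<open>The dual recurrence collapses the coefficient of y at m - 1 to a single
      \<open>\<gamma>0\<close> term. The y(m) term cancels in the minor, being proportional to its
      other row.\<close>
    have row: "y (int k) = y (int m + 1) * P (m + r + 1) (int k - int m - 1)
      + y (int m) * (P (m + r) (int k - int m) - [:- \<beta> (m + r), 1:] * P (m + r + 1) (int k - int m - 1))
      - y (int m - 1) * smult (\<gamma>0 (m + r)) (P (m + r + 2) (int k - int m - 2))"
      if "solves_from \<beta> \<gamma>0 \<gamma>1 r (a + 2) y" for y
      using solution_expansion[OF that \<open>a \<le> k\<close>] unfolding P first
      by (simp add: m algebra_simps smult_diff_right numeral_eq_Suc del: mult_pCons_left mult_pCons_right)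
    show ?thesis
      unfolding uv[THEN row] by algebra
  qed
  have "Delta \<beta> \<gamma>0 \<gamma>1 r (int n) = det (vector
       [vector [X (int n), Y (int n), Z (int n)],
        vector [X (int n + 1), Y (int n + 1), Z (int n + 1)],
        vector [X (int n + 2), Y (int n + 2), Z (int n + 2)]] :: complex poly ^ 3 ^ 3)"
    by (simp add: Delta_def Let_def X_def Y_def Z_def P add.commute)
  then show ?thesis
    using split[unfolded minor]
    by (simp add: X_def Y_def Z_def u_def v_def det_2 vector_2 algebra_simps)
qed

end
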